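(* Let $a,b,c,d$ be integers with $d>0$, $\gcd(a,b,c)=1$ and $a^2+b^2+c^2=3d^2$, and put $q=a^2+b^2$. For integers $r,s$ with $s^2+3r^2=2q$ define $$\zeta_1=-\frac{rac+dbs}{q},\quad \zeta_2=\frac{das-bcr}{q},\quad \zeta_3=r,$$ $$\eta_1=-\frac{db(s-3r)+ac(r+s)}{2q},\quad \eta_2=\frac{da(s-3r)-bc(r+s)}{2q},\quad \eta_3=\frac{r+s}{2},$$ and $\vec\zeta=(\zeta_1,\zeta_2,\zeta_3)$, $\vec\eta=(\eta_1,\eta_2,\eta_3)$. Then: (1) There exist integers $r,s$ with $s^2+3r^2=2q$ for which all six numbers $\zeta_i,\eta_i$ are integers; such $r,s$ can be computed by taking $s+i\sqrt3\, r$ to be a greatest common divisor of $ac-i\sqrt3\, bd$ and $2q$ in the ring $\mathbb Z[i\sqrt3]$. For such a choice, for all integers $m,n$ the points $O=(0,0,0)$, $P=m\vec\zeta-n\vec\eta$, $Q=n\vec\zeta-(n-m)\vec\eta$ form an equilateral triangle with vertices in $\mathbb Z^3$ lying in the plane $ax+by+cz=0$ (nondegenerate when $(m,n)\neq(0,0)$). (2) (Essential uniqueness of the parametrization.) Conversely, for such a choice of $r,s$, every equilateral triangle with vertices in $\mathbb Z^3$ lying in a plane with normal vector $(a,b,c)$ is, after a translation by an integer vector moving one of its vertices to the origin $O$, of the form $O,\ m\vec\zeta-n\vec\eta,\ n\vec\zeta-(n-m)\vec\eta$ for some integers $m,n$ (up to labeling of the two vertices other than $O$). (3) Every equilateral triangle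 with vertices in $\mathbb Z^3$ lies in a plane with a normal vector $(a,b,c)$ for some integers $a,b,c,d$ as above, and hence is obtained (up to an integer translation) from such a parametrization. (4) In the case $b=c$, one may take $\vec\zeta=(0,d,-d)$ and $\vec\eta=\left(-b,\frac{a+d}{2},\frac{a-d}{2}\right)$, and statements (1) and (2) hold with these vectors.
   Context: An equilateral triangle in $\mathbb Z^3$ means a set of three points with integer coordinates whose pairwise Euclidean distances are all equal. $\mathbb Z[i\sqrt3]=\{x+iy\sqrt3: x,y\in\mathbb Z\}$. The paper phrases the result as: for every solution of $a^2+b^2+c^2=3d^2$ there is "essentially only one parametrization" of the equilateral triangles with vertices in the plane $ax+by+cz=0$, given up to translation by the formulas above. *)

theory Defs
  imports "HOL-Analysis.Analysis" "HOL-Algebra.Divisibility" "HOL-Algebra.Ring"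
begin

definition Zpts :: "(real^3) set"
  where "Zpts = {x. \<forall>i. x $ i \<in> \<int>}"

definition equilateral_triangle :: "(real^3) set \<Rightarrow> bool"
  where "equilateral_triangle T \<longleftrightarrow>
    T \<subseteq> Zpts \<and> card T = 3 \<and> (\<exists>l. \<forall>x\<in>T. \<forall>y\<in>T. x \<noteq> y \<longrightarrow> dist x y = l)"

definition normal_vec :: "int \<Rightarrow> int \<Rightarrow> int \<Rightarrow> real^3"
  where "normal_vec a b c = vector [of_int a, of_int b, of_int c]"

definition in_plane_with_normal :: "int \<Rightarrow> int \<Rightarrow> int \<Rightarrow> (real^3) set \<Rightarrow> bool"
  where "in_plane_with_normal a b c T \<longleftrightarrow> (\<exists>k. \<forall>x\<in>T. normal_vec a b c \<bullet> x = k)"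

definition normal_data :: "int \<Rightarrow> int \<Rightarrow> int \<Rightarrow> int \<Rightarrow> bool"
  where "normal_data a b c d \<longleftrightarrow>
    d > 0 \<and> Gcd {a, b, c} = 1 \<and> a\<^sup>2 + b\<^sup>2 + c\<^sup>2 = 3 * d\<^sup>2"

definition zeta :: "int \<Rightarrow> int \<Rightarrow> int \<Rightarrow> int \<Rightarrow> int \<Rightarrow> int \<Rightarrow> real^3"
  where "zeta a b c d r s = (let q = a\<^sup>2 + b\<^sup>2 in vector
    [- (real_of_int (r * a * c + d * b * s) / real_of_int q),
     real_of_int (d * a * s - b * c * r) / real_of_int q,
     real_of_int r])"

definition eta :: "int \<Rightarrow> int \<Rightarrow> int \<Rightarrow> int \<Rightarrow> int \<Rightarrow> int \<Rightarrow> real^3"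
  where "eta a b c d r s = (let q = a\<^sup>2 + b\<^sup>2 in vector
    [- (real_of_int (d * b * (s - 3 * r) + a * c * (r + s)) / real_of_int (2 * q)),
     real_of_int (d * a * (s - 3 * r) - b * c * (r + s)) / real_of_int (2 * q),
     real_of_int (r + s) / 2])"

definition admissible :: "int \<Rightarrow> int \<Rightarrow> int \<Rightarrow> int \<Rightarrow> int \<Rightarrow> int \<Rightarrow> bool"
  where "admissible a b c d r s \<longleftrightarrow>
    s\<^sup>2 + 3 * r\<^sup>2 = 2 * (a\<^sup>2 + b\<^sup>2) \<and> zeta a b c d r s \<in> Zpts \<and> eta a b c d r s \<in> Zpts"

definition zi3 :: "int \<Rightarrow> int \<Rightarrow> complex"
  where "zi3 x y = of_int x + \<i> * of_int y * of_real (sqrt 3)"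

text \<open>The ring \<open>\<int>[i\<surd>3]\<close>. It is not a GCD domain, so the existence of a greatest common
  divisor of two given elements is not automatic.\<close>

definition Zi3 :: "complex ring"
  where "Zi3 = \<lparr>carrier = {zi3 x y |x y. True}, mult = (*), one = 1, zero = 0, add = (+)\<rparr>"

definition ptP :: "real^3 \<Rightarrow> real^3 \<Rightarrow> int \<Rightarrow> int \<Rightarrow> real^3"
  where "ptP z e m n = of_int m *\<^sub>R z - of_int n *\<^sub>R e"

definition ptQ :: "real^3 \<Rightarrow> real^3 \<Rightarrow> int \<Rightarrow> int \<Rightarrow> real^3"
  where "ptQ z e m n = of_int n *\<^sub>R z - of_int (n - m) *\<^sub>R e"

definition yields_triangles :: "int \<Rightarrow> int \<Rightarrow> int \<Rightarrow> real^3 \<Rightarrow> real^3 \<Rightarrow> bool"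
  where "yields_triangles a b c z e \<longleftrightarrow> (\<forall>m n.
    let P = ptP z e m n; Q = ptQ z e m n in
      P \<in> Zpts \<and> Q \<in> Zpts \<and>
      normal_vec a b c \<bullet> P = 0 \<and> normal_vec a b c \<bullet> Q = 0 \<and>
      dist 0 P = dist 0 Q \<and> dist 0 P = dist P Q \<and>
      ((m, n) \<noteq> (0, 0) \<longrightarrow> equilateral_triangle {0, P, Q} \<and> \<not> collinear {0, P, Q}))"

text \<open>Equality of sets of vertices leaves the labelling of the vertices other than the origin open.
  Any vertex \<open>A\<close> may be the one that is translated to the origin.\<close>

definition obtained_from :: "real^3 \<Rightarrow> real^3 \<Rightarrow> (real^3) set \<Rightarrow> bool"
  where "obtained_from z e T \<longleftrightarrow>
    (\<forall>A\<in>T. \<exists>m n. (\<lambda>x. x - A) ` T = {0, ptP z e m n, ptQ z e m n})"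

definition yields_all_triangles :: "int \<Rightarrow> int \<Rightarrow> int \<Rightarrow> real^3 \<Rightarrow> real^3 \<Rightarrow> bool"
  where "yields_all_triangles a b c z e \<longleftrightarrow>
    (\<forall>T. equilateral_triangle T \<and> in_plane_with_normal a b c T \<longrightarrow> obtained_from z e T)"

lemma zi3_add: "zi3 x y + zi3 u v = zi3 (x + u) (y + v)"
  by (simp add: zi3_def algebra_simps)

lemma zi3_mult: "zi3 x y * zi3 u v = zi3 (x * u - 3 * y * v) (x * v + y * u)"
  by (simp add: zi3_def complex_eq_iff algebra_simps)

lemma cring_Zi3: "cring Zi3"
proof (rule cringI)
  show "abelian_group Zi3"
  proof (rule abelian_groupI)
    show "\<zero>\<^bsub>Zi3\<^esub> \<in> carrier Zi3"
      by (auto simp: Zi3_def zi3_def intro!: exI[of _ 0])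
    show "\<exists>y\<in>carrier Zi3. y \<oplus>\<^bsub>Zi3\<^esub> x = \<zero>\<^bsub>Zi3\<^esub>" if x: "x \<in> carrier Zi3" for x
    proof -
      obtain u v where "x = zi3 u v" using x by (auto simp: Zi3_def)
      then have "zi3 (-u) (-v) + x = 0" by (simp add: zi3_add) (simp add: zi3_def)
      then show ?thesis by (auto simp: Zi3_def)
    qed
  qed (auto simp: Zi3_def zi3_add add_ac, (blast | simp add: algebra_simps)+)
  show "comm_monoid Zi3"
  proof (rule comm_monoidI)
    have "1 = zi3 1 0" by (simp add: zi3_def)
    then show "\<one>\<^bsub>Zi3\<^esub> \<in> carrier Zi3" by (auto simp: Zi3_def)
  qed (auto simp: Zi3_def zi3_mult, (blast | simp add: algebra_simps)+)
qed (auto simp: Zi3_def algebra_simps)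

end

theory Submission
  imports Defs
begin

text \<open>
  Put \<open>n = (a, b, c)\<close>, a primitive vector of length \<open>d\<surd>3\<close>. The map \<open>x \<mapsto> x/2 + (n \<times> x)/(2d)\<close> rotates the
  plane orthogonal to \<open>n\<close> by 60 degrees, and it takes \<open>\<zeta>\<close> to \<open>\<eta>\<close>; moreover \<open>\<zeta>\<close> has squared length \<open>2d\<^sup>2\<close>,
  so that \<open>\<zeta> \<times> \<eta> = d n\<close>. If \<open>0, P, Q\<close> is an integral equilateral triangle orthogonal to \<open>n\<close>, then
  \<open>n \<times> P\<close> is divisible by \<open>d\<close>. As \<open>n\<close> is primitive, this makes \<open>P\<close> parallel to \<open>n\<close> modulo \<open>d\<close>, so the
  cross products of \<open>P\<close> with \<open>\<zeta>\<close> and \<open>\<eta>\<close> are integral multiples of \<open>d n\<close>, and by Cramer's rule the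
  coordinates of \<open>P\<close> in the basis \<open>\<zeta>, \<eta>\<close> are integers.

  For the existence of \<open>r, s\<close>, all of \<open>a, b, c, d\<close> are odd, and although \<open>\<int>[i\<surd>3]\<close> is not a principal
  ideal domain, the ideal generated by \<open>w = ac - i\<surd>3 bd\<close> and \<open>2q\<close> is principal. Its generator
  \<open>s + i\<surd>3 r\<close> has norm \<open>2q\<close> and divides \<open>w\<close>, which makes \<open>\<zeta>\<close> and \<open>\<eta>\<close> integral.

  Finally, the normal vector of a given triangle \<open>0, P, Q\<close> is the primitive part of \<open>P \<times> Q\<close>,
  whose squared length is \<open>3 (P \<bullet> Q)\<^sup>2\<close>.
\<close>

unbundle cross3_syntax

section \<open>Integral vectors and rotations by 60 degrees\<close>

lemma Zpts_closed:
  assumes "x \<in> Zpts" "y \<in> Zpts"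
  shows "x + y \<in> Zpts" "x - y \<in> Zpts" "x \<times> y \<in> Zpts" "x \<bullet> y \<in> \<int>"
  using assms by (simp_all add: Zpts_def forall_3 cross3_def inner_vec_def sum_3)

lemma Zpts_scaleR: "k \<in> \<int> \<Longrightarrow> x \<in> Zpts \<Longrightarrow> k *\<^sub>R x \<in> Zpts"
  by (simp add: Zpts_def)

lemma Zpts_vector: "vector [x, y, z] \<in> Zpts \<longleftrightarrow> x \<in> \<int> \<and> y \<in> \<int> \<and> z \<in> \<int>"
  by (simp add: Zpts_def forall_3)

lemma normal_vec_Zpts: "normal_vec a b c \<in> Zpts"
  by (simp add: normal_vec_def Zpts_vector)

lemma normal_vec_inner: "normal_vec a b c \<bullet> normal_vec a b c = of_int (a\<^sup>2 + b\<^sup>2 + c\<^sup>2)"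
  by (simp add: normal_vec_def inner_vec_def sum_3 power2_eq_square)

text \<open>The vector \<open>u\<close> is Bezout's form of primitivity: pairing with it reads off
  the factor of a multiple of the normal.\<close>

lemma normal_dataD:
  assumes "normal_data a b c d"
  shows "d > 0" "normal_vec a b c \<bullet> normal_vec a b c = 3 * (of_int d)\<^sup>2"
    "\<exists>u\<in>Zpts. u \<bullet> normal_vec a b c = 1"
proof -
  show "d > 0" using assms by (simp add: normal_data_def)
  have "a\<^sup>2 + b\<^sup>2 + c\<^sup>2 = 3 * d\<^sup>2" using assms by (simp add: normal_data_def)
  then show "normal_vec a b c \<bullet> normal_vec a b c = 3 * (of_int d)\<^sup>2"
    by (simp add: normal_vec_inner)
  have 1: "gcd a (gcd b c) = 1" using assms by (simp add: normal_data_def)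
  obtain x y where xy: "x * a + y * gcd b c = 1" using bezout_int[of a "gcd b c"] 1 by auto
  obtain v w where vw: "v * b + w * c = gcd b c" using bezout_int[of b c] by auto
  have e: "x * a + y * v * b + y * w * c = 1" using xy vw[symmetric] by (simp add: algebra_simps)
  have "vector [of_int x, of_int (y * v), of_int (y * w)] \<bullet> normal_vec a b c
      = of_int (x * a + y * v * b + y * w * c)"
    by (simp add: normal_vec_def inner_vec_def sum_3)
  then show "\<exists>u\<in>Zpts. u \<bullet> normal_vec a b c = 1"
    unfolding e by (intro bexI[of _ "vector [of_int x, of_int (y * v), of_int (y * w)]"])
       (auto simp: Zpts_vector)
qed

text \<open>Over a primitive normal \<open>n\<close>, the condition \<open>n \<times> P \<equiv> 0 (mod d)\<close> forces \<open>P\<close> to be a multiple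
  of \<open>n\<close> modulo \<open>d\<close>, so any two such vectors are parallel modulo \<open>d\<close>.\<close>

lemma cross_divisible:
  fixes n P Z R S u :: "real^3" and d :: int
  assumes Z: "n \<in> Zpts" "P \<in> Zpts" "Z \<in> Zpts" "R \<in> Zpts" "S \<in> Zpts" "u \<in> Zpts"
    and u: "u \<bullet> n = 1"
    and perp: "n \<bullet> P = 0" "n \<bullet> Z = 0"
    and R: "n \<times> P = of_int d *\<^sub>R R" and S: "n \<times> Z = of_int d *\<^sub>R S"
  shows "\<exists>t::int. P \<times> Z = of_int (t * d) *\<^sub>R n"
proof -
  define D \<alpha> \<beta> X Y where "D = real_of_int d" and "\<alpha> = u \<bullet> P" and "\<beta> = u \<bullet> Z"
    and "X = - (u \<times> R)" and "Y = - (u \<times> S)"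
  \<comment> \<open>As \<open>u \<bullet> n = 1\<close>, the product
    \<open>u \<times> (n \<times> P)\<close> expands to \<open>\<alpha> n - P\<close>; it is also
    \<open>D\<close> times an integral vector.\<close>
  have P: "P = \<alpha> *\<^sub>R n + D *\<^sub>R X"
    using Lagrange[of u n P] u R by (simp add: \<alpha>_def X_def D_def cross_mult_right algebra_simps)
  have Q: "Z = \<beta> *\<^sub>R n + D *\<^sub>R Y"
    using Lagrange[of u n Z] u S by (simp add: \<beta>_def Y_def D_def cross_mult_right algebra_simps)
  define W where "W = \<alpha> *\<^sub>R (n \<times> Y) - \<beta> *\<^sub>R (n \<times> X) + D *\<^sub>R (X \<times> Y)"
  have PZ: "P \<times> Z = D *\<^sub>R W"
    unfolding P Q W_def cross_add_left cross_add_right cross_mult_left cross_mult_right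
    using cross_skew[of X n] by (simp add: algebra_simps)
  have XY: "X \<in> Zpts" "Y \<in> Zpts"
    using Zpts_closed(3)[OF Z(6,4)] Zpts_closed(3)[OF Z(6,5)]
    by (auto simp: X_def Y_def Zpts_def)
  have ab: "\<alpha> \<in> \<int>" "\<beta> \<in> \<int>" "D \<in> \<int>"
    using Z by (auto simp: \<alpha>_def \<beta>_def D_def Zpts_closed)
  have "W \<in> Zpts" unfolding W_def
    by (intro Zpts_closed Zpts_scaleR ab XY Z)
  then obtain t where t: "u \<bullet> W = of_int t"
    using Z(6) by (meson Zpts_closed(4) Ints_cases)
  have "n \<times> (P \<times> Z) = 0" by (simp add: Lagrange perp)
  then have "P \<times> Z = (u \<bullet> (P \<times> Z)) *\<^sub>R n"
    using Lagrange[of u n "P \<times> Z"] u by simp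
  also have "\<dots> = of_int (t * d) *\<^sub>R n" by (simp add: PZ t D_def mult.commute)
  finally show ?thesis by blast
qed

text \<open>Here \<open>e\<close> is the image of \<open>z\<close> under the rotation \<open>x \<mapsto> x/2 + (n \<times> x)/(2d)\<close> by 60 degrees about
  the axis \<open>n\<close>, whose length is \<open>d\<surd>3\<close>.\<close>

locale rotation_basis =
  fixes n z e :: "real^3" and d :: real
  assumes d_pos: "d > 0" and nn: "n \<bullet> n = 3 * d\<^sup>2" and nz: "n \<bullet> z = 0"
    and zz: "z \<bullet> z = 2 * d\<^sup>2" and rot: "n \<times> z = d *\<^sub>R (2 *\<^sub>R e - z)"
begin

lemma ne: "n \<bullet> e = 0"
proof -
  have "n \<bullet> (d *\<^sub>R (2 *\<^sub>R e - z)) = 0" by (simp flip: rot add: dot_cross_self)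
  then show ?thesis using nz d_pos by (simp add: inner_diff_right)
qed

lemma ze: "z \<bullet> e = d\<^sup>2"
proof -
  have "z \<bullet> (d *\<^sub>R (2 *\<^sub>R e - z)) = 0" by (simp flip: rot add: dot_cross_self)
  then show ?thesis using zz d_pos by (simp add: inner_diff_right)
qed

lemma ee: "e \<bullet> e = 2 * d\<^sup>2"
proof -
  have "(n \<times> z) \<bullet> (n \<times> z) = 6 * d\<^sup>2 * d\<^sup>2" by (simp add: dot_cross nn nz zz)
  then have "d\<^sup>2 * (4 * (e \<bullet> e) - 4 * (z \<bullet> e) + z \<bullet> z) = d\<^sup>2 * (6 * d\<^sup>2)"
    unfolding rot by (simp add: inner_diff_left inner_diff_right inner_commute algebra_simps power2_eq_square)
  then have "4 * (e \<bullet> e) - 4 * (z \<bullet> e) + z \<bullet> z = 6 * d\<^sup>2" using d_pos by simp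
  then show ?thesis by (simp add: ze zz)
qed

text \<open>Cross \<open>z\<close> with both sides of \<open>rot\<close>: the term in
  \<open>z\<close> on the right drops out.\<close>

lemma z_cross_e: "z \<times> e = d *\<^sub>R n"
proof -
  have "z \<times> (n \<times> z) = (2 * d\<^sup>2) *\<^sub>R n" by (simp add: Lagrange zz nz inner_commute)
  then have "(2 * d) *\<^sub>R (z \<times> e) = (2 * d) *\<^sub>R (d *\<^sub>R n)"
    by (simp add: rot cross_mult_right Cross3.right_diff_distrib power2_eq_square mult_ac)
  then show ?thesis using d_pos by (simp only: real_vector.scale_cancel_left) simp
qed

text \<open>On the plane, applying \<open>n \<times>\<close> twice is multiplication by
  \<open>-3 d^2\<close>; this determines the image of \<open>e\<close>.\<close>

lemma rot_e: "n \<times> e = d *\<^sub>R (e - 2 *\<^sub>R z)"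
proof -
  have "d *\<^sub>R (n \<times> (2 *\<^sub>R e - z)) = - (3 * d\<^sup>2) *\<^sub>R z"
    using Lagrange[of n n z] by (simp add: rot cross_mult_right nn nz)
  also have "\<dots> = d *\<^sub>R (- (3 * d) *\<^sub>R z)" by (simp add: power2_eq_square)
  finally have "n \<times> (2 *\<^sub>R e - z) = - (3 * d) *\<^sub>R z"
    using d_pos by (simp only: real_vector.scale_cancel_left) simp
  then have "2 *\<^sub>R (n \<times> e) = d *\<^sub>R (2 *\<^sub>R e - z) - (3 * d) *\<^sub>R z"
    by (simp add: Cross3.right_diff_distrib cross_mult_right rot algebra_simps)
  also have "\<dots> = 2 *\<^sub>R (d *\<^sub>R (e - 2 *\<^sub>R z))"
    by (simp add: vec_eq_iff algebra_simps)
  finally show ?thesis by (simp only: real_vector.scale_cancel_left) simp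
qed

text \<open>Cramer's rule. By the Jacobi identity the difference \<open>V\<close> of the two sides
  is parallel to \<open>z \<times> e\<close>, hence to \<open>n\<close>, but it is also orthogonal
  to \<open>n\<close>.\<close>

lemma expansion:
  assumes P: "n \<bullet> P = 0" and x: "P \<times> e = (x * d) *\<^sub>R n" and y: "z \<times> P = (y * d) *\<^sub>R n"
  shows "P = x *\<^sub>R z + y *\<^sub>R e"
proof -
  define V where "V = P - x *\<^sub>R z - y *\<^sub>R e"
  have Ve: "V \<times> e = 0" and zV: "z \<times> V = 0"
    using x y by (simp_all add: V_def Cross3.left_diff_distrib Cross3.right_diff_distrib
        cross_mult_left cross_mult_right z_cross_e)
  have "e \<times> V = 0" "V \<times> z = 0" using Ve zV cross_skew[of e V] cross_skew[of V z] by simp_all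
  then have "V \<times> (z \<times> e) = 0" using Jacobi[of V z e] by simp
  then have "V \<times> n = 0" using d_pos by (simp add: z_cross_e cross_mult_right)
  moreover have "V \<bullet> n = 0" using P nz ne by (simp add: V_def inner_diff_right inner_commute[of _ n])
  moreover have "n \<noteq> 0" using nn d_pos by auto
  ultimately have "V = 0" using norm_and_cross_eq_0 by blast
  then show ?thesis by (simp add: V_def algebra_simps)
qed

lemma inner_combination:
  "(x *\<^sub>R z + y *\<^sub>R e) \<bullet> (x *\<^sub>R z + y *\<^sub>R e) = 2 * d\<^sup>2 * (x\<^sup>2 + x * y + y\<^sup>2)"
  by (simp add: inner_add_left inner_add_right zz ee ze inner_commute[of e z] power2_eq_square
      algebra_simps)

end

section \<open>Triangles produced by a rotation basis\<close>

lemma quadratic_form_pos: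
  fixes m n :: real
  assumes "m \<noteq> 0 \<or> n \<noteq> 0"
  shows "m\<^sup>2 - m * n + n\<^sup>2 > 0"
proof -
  have "m\<^sup>2 - m * n + n\<^sup>2 = (m - n / 2)\<^sup>2 + 3 / 4 * n\<^sup>2"
    by (simp add: power2_eq_square field_simps)
  moreover have "\<dots> > 0"
    using assms by (cases "n = 0") (auto intro: add_nonneg_pos)
  ultimately show ?thesis by simp
qed

text \<open>The sides have coordinates \<open>(m, -n)\<close>, \<open>(n, m - n)\<close> and
  \<open>(m - n, -m)\<close>, on which the form \<open>x^2 + x y + y^2\<close> takes one common
  value.\<close>

lemma yields_trianglesI:
  assumes rb: "rotation_basis (normal_vec a b c) z e d" and Z: "z \<in> Zpts" "e \<in> Zpts"
  shows "yields_triangles a b c z e"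
  unfolding yields_triangles_def Let_def
proof (intro allI)
  fix m n :: int
  interpret rotation_basis "normal_vec a b c" z e d by (rule rb)
  define P Q where "P = ptP z e m n" and "Q = ptQ z e m n"
  have Peq: "P = of_int m *\<^sub>R z + (- of_int n) *\<^sub>R e"
    and Qeq: "Q = of_int n *\<^sub>R z + of_int (m - n) *\<^sub>R e"
    and PQeq: "P - Q = of_int (m - n) *\<^sub>R z + (- of_int m) *\<^sub>R e"
    by (simp_all add: P_def Q_def ptP_def ptQ_def algebra_simps)
  define L where "L = 2 * d\<^sup>2 * (of_int m ^ 2 - of_int m * of_int n + of_int n ^ 2 :: real)"
  have L: "P \<bullet> P = L" "Q \<bullet> Q = L" "(P - Q) \<bullet> (P - Q) = L"
    unfolding PQeq unfolding Peq Qeq inner_combination L_def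
    by (simp_all add: algebra_simps power2_eq_square)
  have PQ: "P \<in> Zpts" "Q \<in> Zpts"
    unfolding Peq Qeq by (intro Zpts_closed Zpts_scaleR Z; simp)+
  have perp: "normal_vec a b c \<bullet> P = 0" "normal_vec a b c \<bullet> Q = 0"
    by (simp_all add: Peq Qeq inner_add_right nz ne inner_diff_right)
  have dist: "dist 0 P = sqrt L" "dist 0 Q = sqrt L" "dist P Q = sqrt L"
    using L by (simp_all add: dist_norm norm_eq_sqrt_inner)
  have "equilateral_triangle {0, P, Q} \<and> \<not> collinear {0, P, Q}" if "(m, n) \<noteq> (0, 0)"
  proof -
    have Lpos: "L > 0" using quadratic_form_pos[of "of_int m" "of_int n"] that d_pos
      by (auto simp: L_def)
    then have ne: "P \<noteq> 0" "Q \<noteq> 0" "P \<noteq> Q" using L by auto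
    have "0 \<in> Zpts" by (simp add: Zpts_def)
    then have "equilateral_triangle {0, P, Q}"
      unfolding equilateral_triangle_def using PQ ne dist
      by (auto simp: dist_commute intro!: exI[of _ "sqrt L"])
    moreover have "P \<times> Q \<noteq> 0"
    proof
      assume "P \<times> Q = 0"
      then have "(P \<times> Q) \<bullet> (P \<times> Q) = 0" by simp
      moreover have "P \<bullet> Q = L / 2"
        using L by (simp add: inner_diff_left inner_diff_right inner_commute)
      ultimately have "L * L - (L / 2) * (L / 2) = 0"
        using L by (simp add: dot_cross inner_commute)
      then show False using Lpos by simp
    qed
    ultimately show ?thesis by (simp add: cross_eq_0)
  qed
  then show "ptP z e m n \<in> Zpts \<and> ptQ z e m n \<in> Zpts \<and>
      normal_vec a b c \<bullet> ptP z e m n = 0 \<and> normal_vec a b c \<bullet> ptQ z e m n = 0 \<and>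
      dist 0 (ptP z e m n) = dist 0 (ptQ z e m n) \<and>
      dist 0 (ptP z e m n) = dist (ptP z e m n) (ptQ z e m n) \<and>
      ((m, n) \<noteq> (0, 0) \<longrightarrow> equilateral_triangle {0, ptP z e m n, ptQ z e m n} \<and>
         \<not> collinear {0, ptP z e m n, ptQ z e m n})"
    using PQ perp dist by (simp flip: P_def Q_def)
qed

section \<open>Every triangle in the plane comes from the basis\<close>

lemma equilateral_translate:
  assumes T: "equilateral_triangle T" and A: "A \<in> T"
  obtains P Q where "(\<lambda>x. x - A) ` T = {0, P, Q}" "P \<in> Zpts" "Q \<in> Zpts" "P \<noteq> 0"
    "Q \<bullet> Q = P \<bullet> P" "2 * (P \<bullet> Q) = P \<bullet> P"
    "\<forall>n k. (\<forall>x\<in>T. n \<bullet> x = k) \<longleftrightarrow> n \<bullet> A = k \<and> n \<bullet> P = 0 \<and> n \<bullet> Q = 0"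
proof -
  have "card (T - {A}) = 2" using T A by (simp add: equilateral_triangle_def)
  then obtain B C where BC: "T - {A} = {B, C}" "B \<noteq> C" by (auto simp: card_2_iff)
  then have ABC: "T = {A, B, C}" "A \<noteq> B" "A \<noteq> C" "B \<noteq> C" using A by auto
  obtain l where l: "\<forall>x\<in>T. \<forall>y\<in>T. x \<noteq> y \<longrightarrow> dist x y = l"
    using T unfolding equilateral_triangle_def by auto
  have "norm (B - A) = l" "norm (C - A) = l" "norm (B - C) = l"
    using l ABC by (auto simp: dist_norm)
  then have sq: "(B - A) \<bullet> (B - A) = l\<^sup>2" "(C - A) \<bullet> (C - A) = l\<^sup>2" "(B - C) \<bullet> (B - C) = l\<^sup>2"
    by (simp_all flip: power2_norm_eq_inner)
  show ?thesis
  proof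
    show "(\<lambda>x. x - A) ` T = {0, B - A, C - A}" by (simp add: ABC)
    show "B - A \<in> Zpts" "C - A \<in> Zpts"
      using T ABC by (auto simp: equilateral_triangle_def intro: Zpts_closed)
    show "B - A \<noteq> 0" using ABC by simp
    show "(C - A) \<bullet> (C - A) = (B - A) \<bullet> (B - A)" using sq by simp
    have "(B - C) \<bullet> (B - C) = (B - A) \<bullet> (B - A) + (C - A) \<bullet> (C - A) - 2 * ((B - A) \<bullet> (C - A))"
      by (simp add: inner_diff_left inner_diff_right inner_commute)
    then show "2 * ((B - A) \<bullet> (C - A)) = (B - A) \<bullet> (B - A)" using sq by simp
    show "\<forall>n k. (\<forall>x\<in>T. n \<bullet> x = k) \<longleftrightarrow> n \<bullet> A = k \<and> n \<bullet> (B - A) = 0 \<and> n \<bullet> (C - A) = 0"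
      by (auto simp: ABC inner_diff_right)
  qed
qed

text \<open>The two cases are the orientations: \<open>P \<times> Q\<close> is parallel to
  \<open>n\<close> and its length is known, so only the sign of its factor is open.\<close>

lemma sixty_degree_rotation:
  fixes n P Q :: "real^3" and d :: real
  assumes d: "d > 0" and nn: "n \<bullet> n = 3 * d\<^sup>2" and perp: "n \<bullet> P = 0" "n \<bullet> Q = 0"
    and P0: "P \<noteq> 0" and QQ: "Q \<bullet> Q = P \<bullet> P" and PQ: "2 * (P \<bullet> Q) = P \<bullet> P"
  shows "n \<times> P = d *\<^sub>R (2 *\<^sub>R Q - P) \<or> n \<times> Q = d *\<^sub>R (2 *\<^sub>R P - Q)"
proof -
  define L where "L = P \<bullet> P"
  have L: "L > 0" using P0 by (simp add: L_def)
  define t where "t = ((P \<times> Q) \<bullet> n) / (3 * d\<^sup>2)"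
  have "n \<times> (n \<times> (P \<times> Q)) = 0" by (simp add: Lagrange perp)
  then have "(3 * d\<^sup>2) *\<^sub>R (P \<times> Q) = (n \<bullet> (P \<times> Q)) *\<^sub>R n"
    using Lagrange[of n n "P \<times> Q"] by (simp add: nn)
  also have "\<dots> = (3 * d\<^sup>2) *\<^sub>R (t *\<^sub>R n)" using d by (simp add: t_def inner_commute)
  finally have t: "P \<times> Q = t *\<^sub>R n" using d by (simp only: real_vector.scale_cancel_left) simp
  have "(P \<times> Q) \<bullet> (P \<times> Q) = 3 / 4 * L\<^sup>2"
    using QQ by (simp add: dot_cross L_def PQ[symmetric] inner_commute[of Q P] power2_eq_square)
  then have "(2 * d * t)\<^sup>2 = L\<^sup>2" by (simp add: t nn power2_eq_square algebra_simps)
  then have "2 * d * t = L \<or> 2 * d * t = - L" by (simp add: power2_eq_iff)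
  then show ?thesis
  proof
    assume h: "2 * d * t = L"
    have "t *\<^sub>R (n \<times> P) = - (P \<times> (P \<times> Q))"
      using cross_skew[of n P] by (simp add: t cross_mult_right)
    also have "\<dots> = (L / 2) *\<^sub>R (2 *\<^sub>R Q - P)"
      using PQ by (simp add: Lagrange L_def algebra_simps)
    also have "\<dots> = t *\<^sub>R (d *\<^sub>R (2 *\<^sub>R Q - P))" by (simp flip: h add: mult_ac)
    finally show ?thesis using h L by (simp only: real_vector.scale_cancel_left) auto
  next
    assume h: "2 * d * t = - L"
    then have h': "L / 2 = - (t * d)" by (simp add: algebra_simps)
    have "t *\<^sub>R (n \<times> Q) = - (Q \<times> (P \<times> Q))"
      using cross_skew[of n Q] by (simp add: t cross_mult_right)
    also have "\<dots> = - (L / 2) *\<^sub>R (2 *\<^sub>R P - Q)"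
      using PQ QQ by (simp add: Lagrange L_def algebra_simps inner_commute)
    also have "\<dots> = t *\<^sub>R (d *\<^sub>R (2 *\<^sub>R P - Q))" by (simp only: h') simp
    finally show ?thesis using h L by (simp only: real_vector.scale_cancel_left) auto
  qed
qed

text \<open>The rotation formula makes \<open>n \<times> P\<close> divisible by \<open>d\<close>, as
  \<open>cross_divisible\<close> requires. This gives integral coordinates for \<open>P\<close>;
  rotating its expansion gives \<open>Q\<close>.\<close>

lemma rotation_pair_parametrized:
  fixes d :: int
  assumes rb: "rotation_basis n z e d" and Z: "n \<in> Zpts" "z \<in> Zpts" "e \<in> Zpts" "P \<in> Zpts" "Q \<in> Zpts"
    and u: "u \<in> Zpts" "u \<bullet> n = 1" and perp: "n \<bullet> P = 0"
    and rotP: "n \<times> P = of_int d *\<^sub>R (2 *\<^sub>R Q - P)"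
  obtains k l where "P = ptP z e k l" "Q = ptQ z e k l"
proof -
  interpret rotation_basis n z e d by (rule rb)
  have Z2: "2 *\<^sub>R Q - P \<in> Zpts" "2 *\<^sub>R e - z \<in> Zpts" "e - 2 *\<^sub>R z \<in> Zpts"
    by (intro Zpts_closed Zpts_scaleR Z; simp)+
  obtain x where x: "P \<times> e = of_int (x * d) *\<^sub>R n"
    using cross_divisible[OF Z(1,4,3) Z2(1,3) u perp ne rotP rot_e] by blast
  obtain y where y: "z \<times> P = of_int (y * d) *\<^sub>R n"
    using cross_divisible[OF Z(1,2,4) Z2(2,1) u nz perp rot rotP] by blast
  have P: "P = of_int x *\<^sub>R z + of_int y *\<^sub>R e"
    using expansion[OF perp] x y by simp
  have "d *\<^sub>R (2 *\<^sub>R Q - P) = of_int x *\<^sub>R (d *\<^sub>R (2 *\<^sub>R e - z)) + of_int y *\<^sub>R (d *\<^sub>R (e - 2 *\<^sub>R z))"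
    by (simp only: rot[symmetric] rot_e[symmetric] rotP[symmetric])
       (simp add: P cross_add_right cross_mult_right)
  also have "\<dots> = d *\<^sub>R (of_int x *\<^sub>R (2 *\<^sub>R e - z) + of_int y *\<^sub>R (e - 2 *\<^sub>R z))"
    by (simp add: algebra_simps)
  finally have "2 *\<^sub>R Q - P = of_int x *\<^sub>R (2 *\<^sub>R e - z) + of_int y *\<^sub>R (e - 2 *\<^sub>R z)"
    using d_pos by (simp only: real_vector.scale_cancel_left) simp
  then have "2 *\<^sub>R Q = 2 *\<^sub>R ptQ z e x (- y)"
    by (simp add: P ptQ_def vec_eq_iff algebra_simps)
  then have "Q = ptQ z e x (- y)" by (simp only: real_vector.scale_cancel_left) simp
  moreover have "P = ptP z e x (- y)" by (simp add: P ptP_def)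
  ultimately show ?thesis using that by blast
qed

lemma yields_all_trianglesI:
  assumes nd: "normal_data a b c d" and rb: "rotation_basis (normal_vec a b c) z e d"
    and Z: "z \<in> Zpts" "e \<in> Zpts"
  shows "yields_all_triangles a b c z e"
  unfolding yields_all_triangles_def obtained_from_def
proof (intro allI impI ballI)
  fix T A assume "equilateral_triangle T \<and> in_plane_with_normal a b c T" and A: "A \<in> T"
  then have T: "equilateral_triangle T" and pl: "in_plane_with_normal a b c T" by auto
  let ?n = "normal_vec a b c"
  obtain P Q where PQ: "(\<lambda>x. x - A) ` T = {0, P, Q}" "P \<in> Zpts" "Q \<in> Zpts" "P \<noteq> 0"
    "Q \<bullet> Q = P \<bullet> P" "2 * (P \<bullet> Q) = P \<bullet> P"
    "\<forall>n k. (\<forall>x\<in>T. n \<bullet> x = k) \<longleftrightarrow> n \<bullet> A = k \<and> n \<bullet> P = 0 \<and> n \<bullet> Q = 0"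
    by (rule equilateral_translate[OF T A])
  have perp: "?n \<bullet> P = 0" "?n \<bullet> Q = 0" using pl PQ(7) by (auto simp: in_plane_with_normal_def)
  obtain u where u: "u \<in> Zpts" "u \<bullet> ?n = 1" using normal_dataD(3)[OF nd] by blast
  have "of_int d > (0::real)" using normal_dataD(1)[OF nd] by simp
  from sixty_degree_rotation[OF this normal_dataD(2)[OF nd] perp PQ(4-6)]
  show "\<exists>m n. (\<lambda>x. x - A) ` T = {0, ptP z e m n, ptQ z e m n}"
  proof
    assume "?n \<times> P = of_int d *\<^sub>R (2 *\<^sub>R Q - P)"
    from rotation_pair_parametrized[OF rb normal_vec_Zpts Z PQ(2,3) u perp(1) this]
    obtain k l where "P = ptP z e k l" "Q = ptQ z e k l" .
    with PQ(1) show ?thesis by auto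
  next
    \<comment> \<open>In the opposite orientation \<open>P\<close> and \<open>Q\<close> exchange
      roles, which the set of vertices does not see.\<close>
    assume "?n \<times> Q = of_int d *\<^sub>R (2 *\<^sub>R P - Q)"
    from rotation_pair_parametrized[OF rb normal_vec_Zpts Z PQ(3,2) u perp(2) this]
    obtain k l where "Q = ptP z e k l" "P = ptQ z e k l" .
    with PQ(1) show ?thesis by (auto simp: insert_commute)
  qed
qed

section \<open>An ideal of \<open>\<int>[i\<surd>3]\<close>\<close>

lemma zi3_inject: "zi3 x y = zi3 u v \<longleftrightarrow> x = u \<and> y = v"
  by (auto simp: zi3_def complex_eq_iff)

lemma zi3_divides_iff:
  "zi3 s r divides\<^bsub>Zi3\<^esub> zi3 x y \<longleftrightarrow> (\<exists>u v. x = s * u - 3 * r * v \<and> y = s * v + r * u)"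
proof -
  have "(\<exists>z\<in>carrier Zi3. zi3 x y = zi3 s r \<otimes>\<^bsub>Zi3\<^esub> z) \<longleftrightarrow> (\<exists>u v. zi3 x y = zi3 s r * zi3 u v)"
    unfolding Zi3_def by auto
  then show ?thesis unfolding factor_def zi3_mult zi3_inject .
qed

text \<open>Rounding to a nearest integer. The half-open interval later leaves a single exceptional
  remainder.\<close>

lemma centered_division:
  fixes A N :: int
  assumes "N > 0"
  obtains t where "- N \<le> 2 * (A - N * t)" "2 * (A - N * t) < N"
proof
  define t where "t = (2 * A + N) div (2 * N)"
  have "2 * A + N = 2 * N * t + (2 * A + N) mod (2 * N)" by (simp add: t_def)
  moreover have "0 \<le> (2 * A + N) mod (2 * N)" "(2 * A + N) mod (2 * N) < 2 * N"
    using assms by auto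
  ultimately show "- N \<le> 2 * (A - N * t)" "2 * (A - N * t) < N"
    by (simp_all add: algebra_simps)
qed

text \<open>An element of smallest norm generates the ideal up to the one position of the quotient, the
  centre of a cell of \<open>\<int>[i\<surd>3]\<close>, where the Euclidean division does not decrease the norm. The
  congruence \<open>x \<equiv> \<plusminus>y (mod 4)\<close>, which holds throughout the ideal, excludes this position.\<close>

lemma odd_ideal_principal:
  fixes X Y M :: int
  assumes X: "odd X" and Y: "odd Y" and M: "4 dvd M"
  obtains s r p1 p2 p3 p4 u v u' v' where
    "s = p1 * X - 3 * p2 * Y + p3 * M" "r = p1 * Y + p2 * X + p4 * M"
    "X = s * u - 3 * r * v" "Y = s * v + r * u" "M = s * u' - 3 * r * v'" "0 = s * v' + r * u'"
proof -
  \<comment> \<open>A pair \<open>(x, y)\<close> stands for \<open>x + i\<surd>3 y\<close>;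
    \<open>J\<close> is the ideal generated by \<open>X + i\<surd>3 Y\<close> and
    \<open>M\<close>.\<close>
  define J where "J = {(x, y). \<exists>p1 p2 p3 p4.
    x = p1 * X - 3 * p2 * Y + p3 * M \<and> y = p1 * Y + p2 * X + p4 * M}"
  have JI: "(p1 * X - 3 * p2 * Y + p3 * M, p1 * Y + p2 * X + p4 * M) \<in> J" for p1 p2 p3 p4
    unfolding J_def by blast
  have XJ: "(X, Y) \<in> J" using JI[of 1 0 0 0] by simp
  have MJ: "(M, 0) \<in> J" using JI[of 0 0 1 0] by simp
  have reduce: "(x - (x' * u - 3 * y' * v), y - (x' * v + y' * u)) \<in> J"
    if z: "(x, y) \<in> J" "(x', y') \<in> J" for x y x' y' u v
  proof -
    obtain p1 p2 p3 p4 where p: "x = p1 * X - 3 * p2 * Y + p3 * M" "y = p1 * Y + p2 * X + p4 * M"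
      using z(1) by (auto simp: J_def)
    obtain q1 q2 q3 q4 where q: "x' = q1 * X - 3 * q2 * Y + q3 * M" "y' = q1 * Y + q2 * X + q4 * M"
      using z(2) by (auto simp: J_def)
    show ?thesis unfolding p q
      using JI[of "p1 - (q1 * u - 3 * q2 * v)" "p2 - (q1 * v + q2 * u)"
          "p3 - (q3 * u - 3 * q4 * v)" "p4 - (q3 * v + q4 * u)"]
      by (simp add: algebra_simps)
  qed
  define nrm where "nrm = (\<lambda>(x, y). nat (x\<^sup>2 + 3 * y\<^sup>2))"
  have "(X, Y) \<in> J \<and> (X, Y) \<noteq> (0, 0)" using XJ X by auto
  then obtain g where g: "g \<in> J \<and> g \<noteq> (0, 0)"
    and gmin: "\<And>z. z \<in> J \<and> z \<noteq> (0, 0) \<Longrightarrow> nrm g \<le> nrm z"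
    using ex_has_least_nat[of "\<lambda>z. z \<in> J \<and> z \<noteq> (0, 0)" _ nrm] by blast
  obtain s r where sr: "g = (s, r)" by (cases g)
  define N where "N = s\<^sup>2 + 3 * r\<^sup>2"
  have Npos: "N > 0" using g sr unfolding N_def
    by (cases "s = 0") (auto intro: add_pos_nonneg)
  \<comment> \<open>The quotient by \<open>g\<close> is \<open>(p + i\<surd>3 q)/2\<close> with
    \<open>p\<close>, \<open>q\<close> of equal parity, that is, an Eisenstein integer.\<close>
  have half: "\<exists>p q. even (p - q) \<and> 2 * x = s * p - 3 * r * q \<and> 2 * y = s * q + r * p"
    if z: "(x, y) \<in> J" for x y
  proof -
    \<comment> \<open>Multiplying by the conjugate of \<open>g\<close> and dividing by
      \<open>N\<close> gives the quotient; \<open>t1\<close> and \<open>t2\<close> round its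
      coordinates.\<close>
    obtain t1 where t1: "- N \<le> 2 * ((x * s + 3 * y * r) - N * t1)"
      "2 * ((x * s + 3 * y * r) - N * t1) < N" using centered_division[OF Npos] .
    obtain t2 where t2: "- N \<le> 2 * ((y * s - x * r) - N * t2)"
      "2 * ((y * s - x * r) - N * t2) < N" using centered_division[OF Npos] .
    define x' y' where "x' = x - (s * t1 - 3 * r * t2)" and "y' = y - (s * t2 + r * t1)"
    have J': "(x', y') \<in> J" unfolding x'_def y'_def using reduce[OF z] g sr by blast
    define A B where "A = x' * s + 3 * y' * r" and "B = y' * s - x' * r"
    have A: "A = (x * s + 3 * y * r) - N * t1" and B: "B = (y * s - x * r) - N * t2"
      unfolding A_def B_def x'_def y'_def N_def by Groebner_Basis.algebra+
    have AB: "- N \<le> 2 * A" "2 * A < N" "- N \<le> 2 * B" "2 * B < N" using t1 t2 A B by auto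
    show ?thesis
    proof (cases "(x', y') = (0, 0)")
      case True
      then show ?thesis unfolding x'_def y'_def
        by (intro exI[of _ "2 * t1"] exI[of _ "2 * t2"]) auto
    next
      case False
      then have "nrm g \<le> nrm (x', y')" using gmin J' by blast
      then have "N \<le> x'\<^sup>2 + 3 * y'\<^sup>2" using Npos by (simp add: nrm_def sr N_def)
      then have "N * N \<le> N * (x'\<^sup>2 + 3 * y'\<^sup>2)" using Npos by simp
      also have "\<dots> = A\<^sup>2 + 3 * B\<^sup>2" unfolding A_def B_def N_def by Groebner_Basis.algebra
      \<comment> \<open>Minimality of \<open>g\<close> bounds the norm of the remainder from below
        and rounding bounds it from above by the same value. Equality then puts the rounding error
        at \<open>-1/2\<close> in both coordinates.\<close>
      finally have le: "4 * N\<^sup>2 \<le> (2 * A)\<^sup>2 + 3 * (2 * B)\<^sup>2" by (simp add: power2_eq_square)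
      have "\<bar>2 * A\<bar> \<le> \<bar>N\<bar>" "\<bar>2 * B\<bar> \<le> \<bar>N\<bar>" using AB by auto
      then have "(2 * A)\<^sup>2 \<le> N\<^sup>2" "(2 * B)\<^sup>2 \<le> N\<^sup>2" by (simp_all only: abs_le_square_iff)
      with le have "(2 * A)\<^sup>2 = N\<^sup>2" "(2 * B)\<^sup>2 = N\<^sup>2" by auto
      then have "2 * A = N \<or> 2 * A = - N" "2 * B = N \<or> 2 * B = - N"
        by (simp_all only: power2_eq_iff)
      then have AN: "2 * A = - N" "2 * B = - N" using AB by auto
      have "N * (2 * x') = s * (2 * A) - 3 * r * (2 * B)" unfolding A_def B_def N_def by Groebner_Basis.algebra
      also have "\<dots> = N * (- s + 3 * r)" unfolding AN by (simp add: algebra_simps)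
      finally have x2: "2 * x' = - s + 3 * r" using Npos by simp
      have "N * (2 * y') = s * (2 * B) + r * (2 * A)" unfolding A_def B_def N_def by Groebner_Basis.algebra
      also have "\<dots> = N * (- s - r)" unfolding AN by (simp add: algebra_simps)
      finally have y2: "2 * y' = - s - r" using Npos by simp
      show ?thesis using x2 y2 unfolding x'_def y'_def
        by (intro exI[of _ "2 * t1 - 1"] exI[of _ "2 * t2 - 1"]) (auto simp: algebra_simps)
    qed
  qed
  obtain \<epsilon> :: int where eps: "\<epsilon> * \<epsilon> = 1" and XY: "4 dvd X - \<epsilon> * Y"
  proof -
    have "4 dvd X - 1 * Y \<or> 4 dvd X - (- 1) * Y" using X Y by presburger
    then show ?thesis using that[of 1] that[of "- 1"] by auto
  qed
  have cong: "4 dvd x - \<epsilon> * y" if z: "(x, y) \<in> J" for x y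
  proof -
    obtain p1 p2 p3 p4 where p: "x = p1 * X - 3 * p2 * Y + p3 * M" "y = p1 * Y + p2 * X + p4 * M"
      using z by (auto simp: J_def)
    have "x - \<epsilon> * y = (p1 - \<epsilon> * p2) * (X - \<epsilon> * Y) + (p3 - \<epsilon> * p4) * M - 4 * (p2 * Y)"
      unfolding p using eps by Groebner_Basis.algebra
    then show ?thesis using XY M by simp
  qed
  have "4 dvd s - \<epsilon> * r" using cong g sr by blast
  then obtain k where k: "s = \<epsilon> * r + 4 * k" by (auto elim!: dvdE simp: algebra_simps)
  have eodd: "odd \<epsilon>" using eps by (metis even_mult_iff odd_one)
  have r_odd: "odd r"
  proof
    assume "even r"
    then obtain r' where r': "r = 2 * r'" by blast
    obtain p q where pq: "even (p - q)" "2 * X = s * p - 3 * r * q" using half[OF XJ] by blast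
    have "2 * X = 2 * ((\<epsilon> * r' + 2 * k) * p - 3 * r' * q)"
      unfolding pq(2) k r' by (simp add: algebra_simps)
    then have "X = (\<epsilon> * r' + 2 * k) * p - 3 * r' * q" by simp
    then show False using X pq(1) eodd by auto
  qed
  \<comment> \<open>Odd \<open>p\<close>, \<open>q\<close> are now excluded: the congruence modulo 4
    makes \<open>q * r\<close> even, and \<open>r\<close> is odd.\<close>
  have gen: "\<exists>u v. x = s * u - 3 * r * v \<and> y = s * v + r * u" if z: "(x, y) \<in> J" for x y
  proof -
    obtain p q where pq: "even (p - q)" "2 * x = s * p - 3 * r * q" "2 * y = s * q + r * p"
      using half[OF z] by blast
    have "2 * (x - \<epsilon> * y) = (s * p - 3 * r * q) - \<epsilon> * (s * q + r * p)"
      unfolding pq(2,3)[symmetric] by (simp add: algebra_simps)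
    also have "\<dots> = 4 * (k * p - q * r - \<epsilon> * k * q)" unfolding k using eps by Groebner_Basis.algebra
    finally have "x - \<epsilon> * y = 2 * (k * p - q * r - \<epsilon> * k * q)" by simp
    then have "even (k * p - q * r - \<epsilon> * k * q)" using cong[OF z] by presburger
    then have "even p" "even q" using pq(1) r_odd eodd by auto
    then obtain p' q' where "p = 2 * p'" "q = 2 * q'" by (auto elim!: evenE)
    with pq(2,3) show ?thesis by (intro exI[of _ p'] exI[of _ q']) auto
  qed
  obtain p1 p2 p3 p4 where p: "s = p1 * X - 3 * p2 * Y + p3 * M" "r = p1 * Y + p2 * X + p4 * M"
    using g sr by (auto simp: J_def)
  show ?thesis using gen[OF XJ] gen[OF MJ] p that by metis
qed

section \<open>Parity of the normal data and the greatest common divisor\<close>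

lemma prime_dvd_square: "Factorial_Ring.prime p \<Longrightarrow> p dvd x\<^sup>2 \<Longrightarrow> p dvd x" for p x :: int
  by (rule prime_dvd_power)

text \<open>Squares are 0 or 1 modulo 4, so the four numbers are all odd or all even; primitivity
  excludes the latter.\<close>

lemma normal_data_odd:
  assumes "normal_data a b c d"
  shows "odd a" "odd b" "odd c" "odd d"
proof -
  have eq: "a\<^sup>2 + b\<^sup>2 + c\<^sup>2 = 3 * d\<^sup>2" and g: "Gcd {a, b, c} = 1" using assms by (auto simp: normal_data_def)
  have sq: "x\<^sup>2 mod 4 = (if even x then 0 else 1)" for x :: int
  proof (cases "even x")
    case True then show ?thesis by (auto elim!: evenE simp: power2_eq_square)
  next
    case False
    then obtain y where "x = 2 * y + 1" by (auto elim: oddE)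
    then have "x\<^sup>2 = 4 * (y\<^sup>2 + y) + 1" by (simp add: power2_eq_square algebra_simps)
    with False show ?thesis by presburger
  qed
  have "(a\<^sup>2 mod 4 + b\<^sup>2 mod 4 + c\<^sup>2 mod 4) mod 4 = (3 * (d\<^sup>2 mod 4)) mod 4"
    using eq by (metis mod_add_eq mod_mult_right_eq mod_add_left_eq)
  moreover have "\<not> (even a \<and> even b \<and> even c)"
  proof
    assume "even a \<and> even b \<and> even c"
    then have "2 dvd Gcd {a, b, c}" by simp
    with g show False by simp
  qed
  ultimately have "odd a \<and> odd b \<and> odd c \<and> odd d" unfolding sq by (auto split: if_splits)
  then show "odd a" "odd b" "odd c" "odd d" by auto
qed

text \<open>With \<open>w = ac - i\<surd>3 bd\<close> and \<open>M = 2q\<close> one has \<open>(w, M)(w\<^sup>*, M) = M (k, w, w\<^sup>*, M)\<close>, where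
  \<open>k = (b\<^sup>2 + c\<^sup>2)/2\<close>, and the last factor is the unit ideal; so a generator of \<open>(w, M)\<close> has norm \<open>M\<close>.\<close>

lemma normal_data_gcd:
  assumes nd: "normal_data a b c d"
  obtains s r where "s\<^sup>2 + 3 * r\<^sup>2 = 2 * (a\<^sup>2 + b\<^sup>2)"
    "(zi3 s r) gcdof\<^bsub>Zi3\<^esub> (zi3 (a * c) (- (b * d))) (zi3 (2 * (a\<^sup>2 + b\<^sup>2)) 0)"
proof -
  note odd = normal_data_odd[OF nd]
  have eq: "a\<^sup>2 + b\<^sup>2 + c\<^sup>2 = 3 * d\<^sup>2" and g1: "Gcd {a, b, c} = 1" using nd by (auto simp: normal_data_def)
  define X Y M where "X = a * c" and "Y = - (b * d)" and "M = 2 * (a\<^sup>2 + b\<^sup>2)"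
  have XY: "odd X" "odd Y" using odd by (auto simp: X_def Y_def)
  have "even (a\<^sup>2 + b\<^sup>2)" "even (b\<^sup>2 + c\<^sup>2)" using odd by auto
  then obtain h k where h: "a\<^sup>2 + b\<^sup>2 = 2 * h" and k: "b\<^sup>2 + c\<^sup>2 = 2 * k" unfolding dvd_def by blast
  have "4 dvd M" by (simp add: M_def h)
  then obtain s r p1 p2 p3 p4 u v u' v' where
    p: "s = p1 * X - 3 * p2 * Y + p3 * M" "r = p1 * Y + p2 * X + p4 * M"
    and t: "X = s * u - 3 * r * v" "Y = s * v + r * u" "M = s * u' - 3 * r * v'" "0 = s * v' + r * u'"
    using odd_ideal_principal[OF XY] by metis
  define N where "N = s\<^sup>2 + 3 * r\<^sup>2"
  have nw: "X\<^sup>2 + 3 * Y\<^sup>2 = M * k"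
  proof -
    have "X\<^sup>2 + 3 * Y\<^sup>2 = a\<^sup>2 * c\<^sup>2 + b\<^sup>2 * (3 * d\<^sup>2)"
      by (simp add: X_def Y_def power_mult_distrib)
    also have "\<dots> = (a\<^sup>2 + b\<^sup>2) * (b\<^sup>2 + c\<^sup>2)"
      unfolding eq[symmetric] by (simp add: algebra_simps)
    finally show ?thesis by (simp add: k M_def)
  qed
  \<comment> \<open>The generator divides \<open>w\<close> and \<open>M\<close>, so its norm
    \<open>N\<close> divides both of their norms and the real part of \<open>w M\<close>, which are
    all multiples of \<open>M\<close>.\<close>
  have "M * k = N * (u\<^sup>2 + 3 * v\<^sup>2)" unfolding nw[symmetric] N_def t(1,2) by Groebner_Basis.algebra
  moreover have "M * X = N * (u * u' + 3 * v * v')" using t unfolding N_def by Groebner_Basis.algebra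
  moreover have "M * M = N * (u'\<^sup>2 + 3 * v'\<^sup>2)" using t unfolding N_def by Groebner_Basis.algebra
  ultimately have "N dvd M * k" "N dvd M * X" "N dvd M * M" by auto
  then have "N dvd gcd (M * k) (gcd (M * X) (M * M))" by simp
  also have "\<dots> = normalize (M * gcd k (gcd X M))" by (simp add: gcd_mult_left)
  \<comment> \<open>A common prime is odd since \<open>X\<close> is odd. It divides
    \<open>a^2 + b^2\<close>, \<open>b^2 + c^2\<close> and \<open>a c\<close>, hence each of
    \<open>a\<close>, \<open>b\<close>, \<open>c\<close>.\<close>
  also have "gcd k (gcd X M) = 1"
  proof (rule ccontr)
    assume "gcd k (gcd X M) \<noteq> 1"
    moreover have "gcd k (gcd X M) \<noteq> 0" using XY by auto
    ultimately obtain p where pp: "Factorial_Ring.prime p" and "p dvd gcd k (gcd X M)"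
      using prime_divisor_exists[of "gcd k (gcd X M)"] by auto
    then have pd: "p dvd k" "p dvd X" "p dvd M" by auto
    have "p \<noteq> 2" using pd(2) XY by auto
    then have "\<not> p dvd 2" using pp primes_dvd_imp_eq[of p 2] by auto
    then have pq: "p dvd a\<^sup>2 + b\<^sup>2" using pd(3) pp unfolding M_def by (simp only: prime_dvd_mult_iff) simp
    have pk: "p dvd b\<^sup>2 + c\<^sup>2" using pd(1) k by simp
    have "p dvd a \<or> p dvd c" using pd(2) pp by (simp add: X_def prime_dvd_mult_iff)
    then have "p dvd b\<^sup>2" using pq pk
      by (auto simp: power2_eq_square dvd_add_right_iff dvd_add_left_iff)
    then have pb: "p dvd b" using prime_dvd_square[OF pp] by blast
    then have "p dvd a\<^sup>2" "p dvd c\<^sup>2" using pq pk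
      by (auto simp: power2_eq_square dvd_add_right_iff dvd_add_left_iff)
    then have "p dvd a" "p dvd c" using prime_dvd_square[OF pp] by blast+
    then have "p dvd Gcd {a, b, c}" using pb by simp
    then show False using pp by (simp only: g1 not_prime_unit)
  qed
  finally have NM: "N dvd M" by simp
  \<comment> \<open>For the converse, \<open>N\<close> is the norm of a combination of
    \<open>w\<close> and \<open>M\<close>; modulo \<open>M\<close> it is a multiple of the norm of
    \<open>w\<close>, which \<open>M\<close> divides.\<close>
  have "N = (p1\<^sup>2 + 3 * p2\<^sup>2) * (X\<^sup>2 + 3 * Y\<^sup>2) + M * (2 * (p1 * X - 3 * p2 * Y) * p3 + p3\<^sup>2 * M
      + 6 * (p1 * Y + p2 * X) * p4 + 3 * p4\<^sup>2 * M)"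
    unfolding N_def p by Groebner_Basis.algebra
  then have "M dvd N" unfolding nw by simp
  moreover have "M > 0" using odd by (auto simp: M_def intro!: add_pos_nonneg)
  moreover have "N \<ge> 0" by (simp add: N_def)
  ultimately have "N = M" using NM by (simp add: zdvd_antisym_nonneg)
  have dvd: "zi3 s r divides\<^bsub>Zi3\<^esub> zi3 X Y" "zi3 s r divides\<^bsub>Zi3\<^esub> zi3 M 0"
    using t unfolding zi3_divides_iff by blast+
  \<comment> \<open>A common divisor divides the combination of \<open>w\<close> and
    \<open>M\<close> that represents the generator.\<close>
  have "y divides\<^bsub>Zi3\<^esub> zi3 s r"
    if y': "y \<in> carrier Zi3" "y divides\<^bsub>Zi3\<^esub> zi3 X Y" "y divides\<^bsub>Zi3\<^esub> zi3 M 0" for y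
  proof -
    obtain m n where y: "y = zi3 m n" using y'(1) by (auto simp: Zi3_def)
    obtain i j i' j' where ij: "X = m * i - 3 * n * j" "Y = m * j + n * i"
      "M = m * i' - 3 * n * j'" "0 = m * j' + n * i'"
      using y'(2,3) unfolding y zi3_divides_iff by blast
    have "s = m * (p1 * i - 3 * p2 * j + p3 * i' - 3 * p4 * j') - 3 * n * (p1 * j + p2 * i + p3 * j' + p4 * i')"
      "r = m * (p1 * j + p2 * i + p3 * j' + p4 * i') + n * (p1 * i - 3 * p2 * j + p3 * i' - 3 * p4 * j')"
      using p ij by Groebner_Basis.algebra+
    then show ?thesis unfolding y zi3_divides_iff by blast
  qed
  with dvd have "(zi3 s r) gcdof\<^bsub>Zi3\<^esub> (zi3 X Y) (zi3 M 0)" unfolding isgcd_def by blast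
  with \<open>N = M\<close> show ?thesis using that unfolding N_def X_def Y_def M_def by blast
qed

text \<open>Two greatest common divisors divide each other, and the norm is multiplicative.\<close>

lemma gcd_norm_unique:
  assumes "(zi3 s r) gcdof\<^bsub>Zi3\<^esub> x y" "(zi3 s' r') gcdof\<^bsub>Zi3\<^esub> x y"
  shows "s\<^sup>2 + 3 * r\<^sup>2 = s'\<^sup>2 + 3 * r'\<^sup>2"
proof -
  have norm_dvd: "m\<^sup>2 + 3 * n\<^sup>2 dvd m'\<^sup>2 + 3 * n'\<^sup>2" if d: "zi3 m n divides\<^bsub>Zi3\<^esub> zi3 m' n'" for m n m' n'
  proof -
    obtain u v where uv: "m' = m * u - 3 * n * v" "n' = m * v + n * u"
      using d unfolding zi3_divides_iff by blast
    have "m'\<^sup>2 + 3 * n'\<^sup>2 = (m\<^sup>2 + 3 * n\<^sup>2) * (u\<^sup>2 + 3 * v\<^sup>2)"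
      unfolding uv by (simp add: power2_eq_square algebra_simps)
    then show ?thesis by simp
  qed
  have "zi3 s r \<in> carrier Zi3" "zi3 s' r' \<in> carrier Zi3" by (auto simp: Zi3_def)
  then have "zi3 s r divides\<^bsub>Zi3\<^esub> zi3 s' r'" "zi3 s' r' divides\<^bsub>Zi3\<^esub> zi3 s r"
    using assms unfolding isgcd_def by blast+
  then show ?thesis by (intro zdvd_antisym_nonneg norm_dvd) auto
qed

section \<open>The parametrization\<close>

text \<open>Multiplied by \<open>q\<close>, or by \<open>q^2\<close> for the length, the conditions
  on the two vectors become polynomial identities modulo the given relations.\<close>

lemma zeta_eta_rotation:
  assumes nd: "normal_data a b c d" and sr: "s\<^sup>2 + 3 * r\<^sup>2 = 2 * (a\<^sup>2 + b\<^sup>2)"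
  shows "rotation_basis (normal_vec a b c) (zeta a b c d r s) (eta a b c d r s) d"
proof -
  define A B C D R S where "A = real_of_int a" and "B = real_of_int b" and "C = real_of_int c"
    and "D = real_of_int d" and "R = real_of_int r" and "S = real_of_int s"
  note real_defs = A_def B_def C_def D_def R_def S_def
  define q where "q = A\<^sup>2 + B\<^sup>2"
  have "a \<noteq> 0" using normal_data_odd(1)[OF nd] by auto
  then have q0: "q > 0" by (simp add: q_def A_def add_pos_nonneg)
  have "a\<^sup>2 + b\<^sup>2 + c\<^sup>2 = 3 * d\<^sup>2" using nd by (simp add: normal_data_def)
  then have "real_of_int (a\<^sup>2 + b\<^sup>2 + c\<^sup>2) = of_int (3 * d\<^sup>2)" by simp
  then have CD: "C\<^sup>2 = 3 * D\<^sup>2 - q" by (simp add: real_defs q_def)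
  have "real_of_int (s\<^sup>2 + 3 * r\<^sup>2) = of_int (2 * (a\<^sup>2 + b\<^sup>2))" using sr by simp
  then have SR: "S\<^sup>2 + 3 * R\<^sup>2 = 2 * q" by (simp add: real_defs q_def)
  define z1 z2 e1 e2 where "z1 = - ((R * A * C + D * B * S) / q)" and "z2 = (D * A * S - B * C * R) / q"
    and "e1 = - ((D * B * (S - 3 * R) + A * C * (R + S)) / (2 * q))"
    and "e2 = (D * A * (S - 3 * R) - B * C * (R + S)) / (2 * q)"
  have z: "zeta a b c d r s = vector [z1, z2, R]"
    by (simp add: zeta_def Let_def z1_def z2_def q_def real_defs)
  have e: "eta a b c d r s = vector [e1, e2, (R + S) / 2]"
    by (simp add: eta_def Let_def e1_def e2_def q_def real_defs)
  have n: "normal_vec a b c = vector [A, B, C]" by (simp add: normal_vec_def real_defs)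
  have qz: "q * z1 = - (R * A * C + D * B * S)" "q * z2 = D * A * S - B * C * R"
    and qe: "q * (2 * e1) = - (D * B * (S - 3 * R) + A * C * (R + S))"
      "q * (2 * e2) = D * A * (S - 3 * R) - B * C * (R + S)"
    using q0 by (simp_all add: z1_def z2_def e1_def e2_def field_simps)
  have nz: "A * z1 + B * z2 + C * R = 0"
  proof -
    have "q * (A * z1 + B * z2 + C * R) = 0" using qz q_def by Groebner_Basis.algebra
    then show ?thesis using q0 by simp
  qed
  have zz: "z1\<^sup>2 + z2\<^sup>2 + R\<^sup>2 = 2 * D\<^sup>2"
  proof -
    have "q\<^sup>2 * (z1\<^sup>2 + z2\<^sup>2 + R\<^sup>2) = q\<^sup>2 * (2 * D\<^sup>2)"
      using qz q_def CD SR by Groebner_Basis.algebra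
    then show ?thesis using q0 by simp
  qed
  have rot: "B * R - C * z2 = D * (2 * e1 - z1)" "C * z1 - A * R = D * (2 * e2 - z2)"
    "A * z2 - B * z1 = D * S"
  proof -
    have "q * (B * R - C * z2) = q * (D * (2 * e1 - z1))" "q * (C * z1 - A * R) = q * (D * (2 * e2 - z2))"
      "q * (A * z2 - B * z1) = q * (D * S)"
      using qz qe q_def CD by Groebner_Basis.algebra+
    then show "B * R - C * z2 = D * (2 * e1 - z1)" "C * z1 - A * R = D * (2 * e2 - z2)"
      "A * z2 - B * z1 = D * S"
      using q0 by simp_all
  qed
  show ?thesis
  proof
    show "0 < real_of_int d" using normal_dataD(1)[OF nd] by simp
    show "normal_vec a b c \<bullet> normal_vec a b c = 3 * (real_of_int d)\<^sup>2" by (rule normal_dataD(2)[OF nd])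
    show "normal_vec a b c \<bullet> zeta a b c d r s = 0"
      using nz by (simp add: n z inner_vec_def sum_3)
    show "zeta a b c d r s \<bullet> zeta a b c d r s = 2 * (real_of_int d)\<^sup>2"
      using zz by (simp add: z inner_vec_def sum_3 power2_eq_square D_def)
    show "normal_vec a b c \<times> zeta a b c d r s = real_of_int d *\<^sub>R (2 *\<^sub>R eta a b c d r s - zeta a b c d r s)"
      using rot by (simp add: n z e cross3_def vec_eq_iff forall_3 D_def add_divide_distrib)
  qed
qed

lemma admissible_yields_triangles:
  assumes nd: "normal_data a b c d" and ad: "admissible a b c d r s"
  shows "yields_triangles a b c (zeta a b c d r s) (eta a b c d r s)"
    and "yields_all_triangles a b c (zeta a b c d r s) (eta a b c d r s)"
proof -
  note ad' = ad[unfolded admissible_def]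
  have rb: "rotation_basis (normal_vec a b c) (zeta a b c d r s) (eta a b c d r s) d"
    using zeta_eta_rotation[OF nd] ad' by blast
  show "yields_triangles a b c (zeta a b c d r s) (eta a b c d r s)"
    using yields_trianglesI[OF rb] ad' by blast
  show "yields_all_triangles a b c (zeta a b c d r s) (eta a b c d r s)"
    using yields_all_trianglesI[OF nd rb] ad' by blast
qed

lemma of_int_divide_Ints: "n \<noteq> 0 \<Longrightarrow> n dvd m \<Longrightarrow> real_of_int m / real_of_int n \<in> \<int>"
  by (auto elim!: dvdE)

lemma dvd_if_square: "x\<^sup>2 = n\<^sup>2 * k \<Longrightarrow> n dvd x" for n x k :: int
  by (metis dvd_triv_left pow_divides_pow_iff zero_less_numeral)

text \<open>Only the first and third coordinates need the divisibility of \<open>ac - i\<surd>3 bd\<close>: the second ones are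
  rational, and their squares are integers because both vectors have squared length \<open>2d\<^sup>2\<close>.\<close>

lemma norm_divisor_admissible:
  assumes nd: "normal_data a b c d" and sr: "s\<^sup>2 + 3 * r\<^sup>2 = 2 * (a\<^sup>2 + b\<^sup>2)"
    and dvd: "zi3 s r divides\<^bsub>Zi3\<^esub> zi3 (a * c) (- (b * d))"
  shows "admissible a b c d r s"
proof -
  define q where "q = a\<^sup>2 + b\<^sup>2"
  have "a \<noteq> 0" using normal_data_odd(1)[OF nd] by auto
  then have q0: "q > 0" by (simp add: q_def add_pos_nonneg)
  have CD: "c\<^sup>2 = 3 * d\<^sup>2 - q" using nd by (simp add: normal_data_def q_def)
  have SR: "s\<^sup>2 + 3 * r\<^sup>2 = 2 * q" using sr by (simp add: q_def)
  obtain u v where uv: "a * c = s * u - 3 * r * v" "- (b * d) = s * v + r * u"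
    using dvd unfolding zi3_divides_iff by blast
  have "even (s\<^sup>2 + 3 * r\<^sup>2)" using SR by simp
  then have "even (r + s)" by auto
  then obtain f where f: "r + s = 2 * f" by blast
  \<comment> \<open>Here \<open>ac - i\<surd>3 bd = (s + i\<surd>3 r)(u + i\<surd>3 v)\<close>, so
    the first coordinates are the integers \<open>2v\<close> and \<open>v - u\<close>.\<close>
  have x1: "r * a * c + d * b * s = q * (- 2 * v)" using uv SR by Groebner_Basis.algebra
  have x2: "d * b * (s - 3 * r) + a * c * (r + s) = 2 * q * (u - v)" using uv SR by Groebner_Basis.algebra
  have "(d * a * s - b * c * r)\<^sup>2 + (r * a * c + d * b * s)\<^sup>2 = q\<^sup>2 * (2 * d\<^sup>2 - r\<^sup>2)"
    using q_def CD SR by Groebner_Basis.algebra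
  then have "(d * a * s - b * c * r)\<^sup>2 = q\<^sup>2 * (2 * d\<^sup>2 - r\<^sup>2 - (- 2 * v)\<^sup>2)"
    unfolding x1 by (simp add: algebra_simps power_mult_distrib)
  then have d1: "q dvd d * a * s - b * c * r" by (rule dvd_if_square)
  have "(d * a * (s - 3 * r) - b * c * (r + s))\<^sup>2 + (d * b * (s - 3 * r) + a * c * (r + s))\<^sup>2
      = (2 * q)\<^sup>2 * (2 * d\<^sup>2 - f\<^sup>2)"
    using q_def CD SR f by Groebner_Basis.algebra
  then have "(d * a * (s - 3 * r) - b * c * (r + s))\<^sup>2 = (2 * q)\<^sup>2 * (2 * d\<^sup>2 - f\<^sup>2 - (u - v)\<^sup>2)"
    unfolding x2 by Groebner_Basis.algebra
  then have d2: "2 * q dvd d * a * (s - 3 * r) - b * c * (r + s)" by (rule dvd_if_square)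
  have "q dvd r * a * c + d * b * s" "2 * q dvd d * b * (s - 3 * r) + a * c * (r + s)"
    "2 dvd r + s"
    by (simp_all only: x1 x2 dvd_triv_left) (simp only: f dvd_triv_left)
  with d1 d2 q0 have ints: "real_of_int (r * a * c + d * b * s) / of_int q \<in> \<int>"
    "real_of_int (d * a * s - b * c * r) / of_int q \<in> \<int>"
    "real_of_int (d * b * (s - 3 * r) + a * c * (r + s)) / of_int (2 * q) \<in> \<int>"
    "real_of_int (d * a * (s - 3 * r) - b * c * (r + s)) / of_int (2 * q) \<in> \<int>"
    "real_of_int (r + s) / of_int 2 \<in> \<int>"
    by (intro of_int_divide_Ints; simp)+
  have "zeta a b c d r s \<in> Zpts"
    unfolding zeta_def Let_def Zpts_vector q_def[symmetric] using ints by (simp only: minus_in_Ints_iff Ints_of_int)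
  moreover have "eta a b c d r s \<in> Zpts"
    unfolding eta_def Let_def Zpts_vector q_def[symmetric] using ints by (simp only: minus_in_Ints_iff of_int_numeral)
  ultimately show ?thesis unfolding admissible_def using sr by blast
qed

section \<open>The normal vector of a given triangle\<close>

lemma integer_normal_data:
  fixes x y z e :: int
  assumes sq: "x\<^sup>2 + y\<^sup>2 + z\<^sup>2 = 3 * e\<^sup>2" and e: "e \<noteq> 0"
  obtains g a b c d where "g \<noteq> 0" "normal_data a b c d" "x = g * a" "y = g * b" "z = g * c"
proof -
  define g where "g = gcd x (gcd y z)"
  have g0: "g \<noteq> 0" using assms by (auto simp: g_def)
  define a b c where "a = x div g" and "b = y div g" and "c = z div g"
  have xyz: "x = g * a" "y = g * b" "z = g * c"
    unfolding a_def b_def c_def g_def by (metis dvd_mult_div_cancel dvd_trans gcd_dvd1 gcd_dvd2)+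
  have "g \<ge> 0" by (simp add: g_def)
  then have "gcd (g * a) (gcd (g * b) (g * c)) = g * gcd a (gcd b c)"
    by (simp add: gcd_mult_left abs_mult)
  then have "g = g * gcd a (gcd b c)" unfolding xyz[symmetric] g_def[symmetric] .
  then have g1: "Gcd {a, b, c} = 1" using g0 by simp
  have n: "g\<^sup>2 * (a\<^sup>2 + b\<^sup>2 + c\<^sup>2) = 3 * e\<^sup>2"
    using sq unfolding xyz by (simp add: power_mult_distrib algebra_simps)
  \<comment> \<open>The desired \<open>d\<close> is \<open>e/g\<close> up to sign. It is integral
    because \<open>g\<close> divides \<open>3 e\<close> and then 3 divides the quotient
    \<open>f\<close>.\<close>
  then have "(3 * e)\<^sup>2 = g\<^sup>2 * (3 * (a\<^sup>2 + b\<^sup>2 + c\<^sup>2))" by Groebner_Basis.algebra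
  then have "g dvd 3 * e" by (rule dvd_if_square)
  then obtain f where f: "3 * e = g * f" by blast
  have "g\<^sup>2 * f\<^sup>2 = g\<^sup>2 * (3 * (a\<^sup>2 + b\<^sup>2 + c\<^sup>2))"
    using n f by Groebner_Basis.algebra
  then have f2: "f\<^sup>2 = 3 * (a\<^sup>2 + b\<^sup>2 + c\<^sup>2)" using g0 by simp
  have "Factorial_Ring.prime (3::int)" by simp
  then have "3 dvd f" using prime_dvd_square[of 3 f] f2 by simp
  then obtain d where d: "f = 3 * d" by blast
  have "a\<^sup>2 + b\<^sup>2 + c\<^sup>2 = 3 * \<bar>d\<bar>\<^sup>2" using f2 unfolding d by (simp add: power_mult_distrib)
  moreover have "d \<noteq> 0" using f d e by auto
  ultimately have "normal_data a b c \<bar>d\<bar>" using g1 by (simp add: normal_data_def)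
  with g0 xyz that show ?thesis by blast
qed

lemma equilateral_normal_data:
  assumes T: "equilateral_triangle T"
  obtains a b c d where "normal_data a b c d" "in_plane_with_normal a b c T"
proof -
  have "T \<noteq> {}" using T by (auto simp: equilateral_triangle_def)
  then obtain A where A: "A \<in> T" by blast
  obtain P Q where PQ: "(\<lambda>x. x - A) ` T = {0, P, Q}" "P \<in> Zpts" "Q \<in> Zpts" "P \<noteq> 0"
    "Q \<bullet> Q = P \<bullet> P" "2 * (P \<bullet> Q) = P \<bullet> P"
    "\<forall>n k. (\<forall>x\<in>T. n \<bullet> x = k) \<longleftrightarrow> n \<bullet> A = k \<and> n \<bullet> P = 0 \<and> n \<bullet> Q = 0"
    by (rule equilateral_translate[OF T A])
  obtain e where e: "P \<bullet> Q = of_int e" using Zpts_closed(4)[OF PQ(2,3)] by (auto elim: Ints_cases)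
  have e0: "e \<noteq> 0" using PQ(4,6) e by auto
  have "P \<times> Q \<in> Zpts" using PQ by (intro Zpts_closed)
  then obtain x y z where xyz: "(P \<times> Q) $ 1 = of_int x" "(P \<times> Q) $ 2 = of_int y" "(P \<times> Q) $ 3 = of_int z"
    unfolding Zpts_def by (auto elim!: Ints_cases simp: forall_3)
  \<comment> \<open>Both squared lengths equal \<open>2 (P \<bullet> Q)\<close>, so Lagrange's
    identity leaves \<open>4 - 1\<close> times the square of \<open>P \<bullet> Q\<close>.\<close>
  have "(P \<times> Q) \<bullet> (P \<times> Q) = 3 * (of_int e)\<^sup>2"
    using PQ(5) by (simp add: dot_cross PQ(6)[symmetric] e inner_commute[of Q P] power2_eq_square)
  then have "real_of_int (x\<^sup>2 + y\<^sup>2 + z\<^sup>2) = of_int (3 * e\<^sup>2)"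
    by (simp add: inner_vec_def sum_3 xyz power2_eq_square)
  then have "x\<^sup>2 + y\<^sup>2 + z\<^sup>2 = 3 * e\<^sup>2" by (simp only: of_int_eq_iff)
  then obtain g a b c d where g: "g \<noteq> 0" "normal_data a b c d" "x = g * a" "y = g * b" "z = g * c"
    using integer_normal_data[OF _ e0] by metis
  have n: "P \<times> Q = of_int g *\<^sub>R normal_vec a b c"
    using xyz g by (simp add: vec_eq_iff forall_3 normal_vec_def)
  have "of_int g * (normal_vec a b c \<bullet> P) = 0" "of_int g * (normal_vec a b c \<bullet> Q) = 0"
    unfolding inner_scaleR_left[symmetric] n[symmetric]
    by (simp_all add: dot_cross_self inner_commute[of _ P])
  then have "normal_vec a b c \<bullet> P = 0" "normal_vec a b c \<bullet> Q = 0" using g(1) by simp_all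
  then have "in_plane_with_normal a b c T" unfolding in_plane_with_normal_def using PQ(7) by blast
  with g(2) that show ?thesis by blast
qed

lemma admissible_exists:
  assumes "normal_data a b c d"
  obtains r s where "admissible a b c d r s"
proof -
  obtain s r where "s\<^sup>2 + 3 * r\<^sup>2 = 2 * (a\<^sup>2 + b\<^sup>2)"
    "(zi3 s r) gcdof\<^bsub>Zi3\<^esub> (zi3 (a * c) (- (b * d))) (zi3 (2 * (a\<^sup>2 + b\<^sup>2)) 0)"
    by (rule normal_data_gcd[OF assms])
  then have "admissible a b c d r s" using norm_divisor_admissible[OF assms] by (simp add: isgcd_def)
  then show ?thesis by (rule that)
qed

text \<open>Any greatest common divisor has the norm of the constructed one, namely
  \<open>2q\<close>.\<close>

lemma gcdof_admissible:
  assumes nd: "normal_data a b c d"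
    and g: "(zi3 s r) gcdof\<^bsub>Zi3\<^esub> (zi3 (a * c) (- (b * d))) (zi3 (2 * (a\<^sup>2 + b\<^sup>2)) 0)"
  shows "admissible a b c d r s"
proof (rule norm_divisor_admissible[OF nd])
  obtain s' r' where s': "s'\<^sup>2 + 3 * r'\<^sup>2 = 2 * (a\<^sup>2 + b\<^sup>2)"
    "(zi3 s' r') gcdof\<^bsub>Zi3\<^esub> (zi3 (a * c) (- (b * d))) (zi3 (2 * (a\<^sup>2 + b\<^sup>2)) 0)"
    by (rule normal_data_gcd[OF nd])
  show "s\<^sup>2 + 3 * r\<^sup>2 = 2 * (a\<^sup>2 + b\<^sup>2)" using gcd_norm_unique[OF g s'(2)] s'(1) by simp
  show "zi3 s r divides\<^bsub>Zi3\<^esub> zi3 (a * c) (- (b * d))" using g by (simp add: isgcd_def)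
qed

text \<open>For \<open>b = c\<close> one has \<open>3 d^2 = a^2 + 2 b^2\<close>, so
  \<open>r = -d\<close>, \<open>s = a\<close> satisfy the norm equation; the special vectors are an
  instance of the general ones.\<close>

lemma equal_coordinates_admissible:
  assumes nd: "normal_data a b b d"
  shows "admissible a b b d (- d) a"
    and "zeta a b b d (- d) a = vector [0, of_int d, - of_int d]"
    and "eta a b b d (- d) a = vector [- of_int b, of_int (a + d) / 2, of_int (a - d) / 2]"
proof -
  have eq: "a\<^sup>2 + b\<^sup>2 + b\<^sup>2 = 3 * d\<^sup>2" using nd by (simp add: normal_data_def)
  define q where "q = a\<^sup>2 + b\<^sup>2"
  note odd = normal_data_odd[OF nd]
  have "a \<noteq> 0" using odd(1) by auto
  then have "q > 0" by (simp add: q_def add_pos_nonneg)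
  then have q0: "real_of_int q \<noteq> 0" by simp
  have i: "- d * a * b + d * b * a = 0" "d * a * a - b * b * (- d) = q * d"
    "d * b * (a - 3 * (- d)) + a * b * (- d + a) = 2 * q * b"
    "d * a * (a - 3 * (- d)) - b * b * (- d + a) = q * (a + d)"
    using eq by (simp, (use eq q_def in Groebner_Basis.algebra)+)
  show z: "zeta a b b d (- d) a = vector [0, of_int d, - of_int d]"
    unfolding zeta_def Let_def q_def[symmetric] i using q0 by simp
  show e: "eta a b b d (- d) a = vector [- of_int b, of_int (a + d) / 2, of_int (a - d) / 2]"
    unfolding eta_def Let_def q_def[symmetric] i using q0 by simp
  have "2 dvd a + d" "2 dvd a - d" using odd by auto
  then have "real_of_int (a + d) / of_int 2 \<in> \<int>" "real_of_int (a - d) / of_int 2 \<in> \<int>"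
    by (intro of_int_divide_Ints; simp)+
  moreover have "a\<^sup>2 + 3 * (- d)\<^sup>2 = 2 * (a\<^sup>2 + b\<^sup>2)" using eq by simp
  ultimately show "admissible a b b d (- d) a"
    unfolding admissible_def z e Zpts_vector by simp
qed

theorem theorem2p1:
  shows
    "(\<forall>a b c d. normal_data a b c d \<longrightarrow>
       (\<exists>r s. admissible a b c d r s) \<and>
       (\<exists>r s. (zi3 s r) gcdof\<^bsub>Zi3\<^esub> (zi3 (a * c) (- (b * d))) (zi3 (2 * (a\<^sup>2 + b\<^sup>2)) 0)) \<and>
       (\<forall>r s. (zi3 s r) gcdof\<^bsub>Zi3\<^esub> (zi3 (a * c) (- (b * d))) (zi3 (2 * (a\<^sup>2 + b\<^sup>2)) 0)
          \<longrightarrow> admissible a b c d r s) \<and>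
       (\<forall>r s. admissible a b c d r s
          \<longrightarrow> yields_triangles a b c (zeta a b c d r s) (eta a b c d r s))) \<and>
    (\<forall>a b c d. normal_data a b c d \<longrightarrow>
       (\<forall>r s. admissible a b c d r s
          \<longrightarrow> yields_all_triangles a b c (zeta a b c d r s) (eta a b c d r s))) \<and>
    (\<forall>T. equilateral_triangle T \<longrightarrow>
       (\<exists>a b c d. normal_data a b c d \<and> in_plane_with_normal a b c T \<and>
          (\<exists>r s. admissible a b c d r s \<and>
             obtained_from (zeta a b c d r s) (eta a b c d r s) T))) \<and>
    (\<forall>a b c d. normal_data a b c d \<and> b = c \<longrightarrow>
       (let z = vector [0, of_int d, - of_int d];
            e = vector [- of_int b, of_int (a + d) / 2, of_int (a - d) / 2]
        in (\<exists>r s. admissible a b c d r s \<and> zeta a b c d r s = z \<and> eta a b c d r s = e) \<and>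
           yields_triangles a b c z e \<and> yields_all_triangles a b c z e))"
proof (intro conjI allI impI)
  fix a b c d assume nd: "normal_data a b c d"
  show "\<exists>r s. admissible a b c d r s" using admissible_exists[OF nd] by metis
  show "\<exists>r s. (zi3 s r) gcdof\<^bsub>Zi3\<^esub> (zi3 (a * c) (- (b * d))) (zi3 (2 * (a\<^sup>2 + b\<^sup>2)) 0)"
    using normal_data_gcd[OF nd] by metis
next
  fix a b c d r s assume nd: "normal_data a b c d"
    and g: "(zi3 s r) gcdof\<^bsub>Zi3\<^esub> (zi3 (a * c) (- (b * d))) (zi3 (2 * (a\<^sup>2 + b\<^sup>2)) 0)"
  show "admissible a b c d r s" by (rule gcdof_admissible[OF nd g])
next
  fix a b c d r s assume "normal_data a b c d" "admissible a b c d r s"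
  then show "yields_triangles a b c (zeta a b c d r s) (eta a b c d r s)"
    "yields_all_triangles a b c (zeta a b c d r s) (eta a b c d r s)"
    by (rule admissible_yields_triangles)+
next
  fix T assume T: "equilateral_triangle T"
  obtain a b c d where nd: "normal_data a b c d" and pl: "in_plane_with_normal a b c T"
    by (rule equilateral_normal_data[OF T])
  obtain r s where ad: "admissible a b c d r s" by (rule admissible_exists[OF nd])
  have "obtained_from (zeta a b c d r s) (eta a b c d r s) T"
    using admissible_yields_triangles(2)[OF nd ad] T pl by (simp add: yields_all_triangles_def)
  with nd pl ad show "\<exists>a b c d. normal_data a b c d \<and> in_plane_with_normal a b c T \<and>
      (\<exists>r s. admissible a b c d r s \<and> obtained_from (zeta a b c d r s) (eta a b c d r s) T)"
    by blast
next
  fix a b c d assume "normal_data a b c d \<and> b = c"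
  then have nd: "normal_data a b b d" and "c = b" by auto
  note eq = equal_coordinates_admissible[OF nd]
  show "let z = vector [0, of_int d, - of_int d];
            e = vector [- of_int b, of_int (a + d) / 2, of_int (a - d) / 2]
        in (\<exists>r s. admissible a b c d r s \<and> zeta a b c d r s = z \<and> eta a b c d r s = e) \<and>
           yields_triangles a b c z e \<and> yields_all_triangles a b c z e"
    unfolding Let_def \<open>c = b\<close> using eq admissible_yields_triangles[OF nd eq(1)] by auto
qed

end
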